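(* Let $(X,d)$ and $(X,\delta)$ be two dislocated metric spaces on the same set $X$. Let $S,T:X\to X$ be self-mappings such that: (i) $d(x,y)\le\delta(x,y)$ for all $x,y\in X$; (ii) $(X,d)$ is complete; (iii) $T$ is sequentially continuous with respect to $d$; (iv) there exists $\alpha\in\mathcal{A}_d$ such that \[ \delta(Tx,Sy)\le\alpha\bigl(\delta(x,y),\delta(x,Tx),\delta(y,Sy)\bigr) \] and \[ \delta(Sy,Tx)\le\alpha\bigl(\delta(y,x),\delta(y,Sy),\delta(x,Tx)\bigr) \] for all $x,y\in X$; (v) for every sequence $\{x_n\}$ in $X$ and every $x\in X$, whenever $x_n\to x$ in $d$, one has $\delta(x_n,x)\to 0$. Then $S$ and $T$ have a unique common fixed point $z\in X$. Moreover, $d(z,z)=\delta(z,z)=0$.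
   Context: Write $\mathbb{R}_+=[0,\infty)$. A dislocated metric on a non-empty set $X$ is a function $d:X\times X\to\mathbb{R}_+$ such that for all $x,y,z\in X$: (i) $d(x,y)=d(y,x)$; (ii) $d(x,y)=0$ implies $x=y$; (iii) $d(x,y)\le d(x,z)+d(z,y)$. (The self-distance $d(x,x)$ is not required to be zero.) Then $(X,d)$ is called a dislocated metric space. A sequence $\{x_n\}$ in $X$ is $d$-Cauchy if for every $\varepsilon>0$ there is $n_0\in\mathbb{N}$ with $d(x_m,x_n)<\varepsilon$ for all $m,n\ge n_0$ (including $m=n$). A sequence $\{x_n\}$ converges to $x\in X$ with respect to $d$ (written $x_n\to x$ in $d$) if $\lim_{n\to\infty}d(x_n,x)=0$. $(X,d)$ is complete if every $d$-Cauchy sequence converges with respect to $d$ to some point of $X$. A map $T:X\to X$ is sequentially continuous with respect to $d$ if for every $x\in X$, $x_n\to x$ in $d$ implies $Tx_n\to Tx$ in $d$. The class $\mathcal{A}_d$ consists of all functions $\alpha:\mathbb{R}_+^3\to\mathbb{R}_+$ such that: (A1) $\alpha$ is continuous on $\mathbb{R}_+^3$; (A2) there exists a constant $k_\alpha\in[0,1)$ such that, for all $a,b\in\mathbb{R}_+$, whenever $a\le\alpha(a,b,b)$ or $a\le\alpha(b,a,b)$ or $a\le\alpha(b,b,a)$, then $a\le k_\alpha b$. (The subscript $d$ in $\mathcal{A}_d$ is part of the name of the class and does not refer to the particular dislocated metric $d$.) A common fixed point of $S$ and $T$ is a point $z\in X$ with $Sz=Tz=z$. *)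

theory Defs
  imports "HOL-Analysis.Analysis"
begin

text \<open>As for \<^locale>\<open>Metric_space\<close>, the space is an explicit carrier set, so that two dislocated
  metrics on the same set can be compared. All conditions, including nonnegativity, are imposed on
  the carrier only; \<^term>\<open>d x x = (0::real)\<close> is not required.\<close>

locale dislocated_metric_space =
  fixes X :: "'a set" and d :: "'a \<Rightarrow> 'a \<Rightarrow> real"
  assumes nonempty: "X \<noteq> {}"
    and nonneg: "\<lbrakk>x \<in> X; y \<in> X\<rbrakk> \<Longrightarrow> 0 \<le> d x y"
    and commute: "\<lbrakk>x \<in> X; y \<in> X\<rbrakk> \<Longrightarrow> d x y = d y x"
    and eq_if_zero: "\<lbrakk>x \<in> X; y \<in> X; d x y = 0\<rbrakk> \<Longrightarrow> x = y"
    and triangle: "\<lbrakk>x \<in> X; y \<in> X; z \<in> X\<rbrakk> \<Longrightarrow> d x y \<le> d x z + d z y"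
begin

definition dcauchy :: "(nat \<Rightarrow> 'a) \<Rightarrow> bool" where
  "dcauchy xs \<longleftrightarrow> range xs \<subseteq> X \<and> (\<forall>\<epsilon>>0. \<exists>n0. \<forall>m\<ge>n0. \<forall>n\<ge>n0. d (xs m) (xs n) < \<epsilon>)"

definition dconverges :: "(nat \<Rightarrow> 'a) \<Rightarrow> 'a \<Rightarrow> bool" where
  "dconverges xs x \<longleftrightarrow> range xs \<subseteq> X \<and> x \<in> X \<and> (\<lambda>n. d (xs n) x) \<longlonglongrightarrow> 0"

definition dcomplete :: bool where
  "dcomplete \<longleftrightarrow> (\<forall>xs. dcauchy xs \<longrightarrow> (\<exists>x. dconverges xs x))"

definition seq_continuous :: "('a \<Rightarrow> 'a) \<Rightarrow> bool" where
  "seq_continuous T \<longleftrightarrow>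
     (\<forall>x\<in>X. \<forall>xs. dconverges xs x \<longrightarrow> dconverges (\<lambda>n. T (xs n)) (T x))"

end

text \<open>Functions on the nonnegative octant are represented by total functions on the reals whose
  values outside the octant are unconstrained.\<close>

definition class_A :: "(real \<Rightarrow> real \<Rightarrow> real \<Rightarrow> real) set" where
  "class_A = {\<alpha>.
     (\<forall>a\<ge>0. \<forall>b\<ge>0. \<forall>c\<ge>0. 0 \<le> \<alpha> a b c) \<and>
     continuous_on ({0..} \<times> {0..} \<times> {0..}) (\<lambda>(a, b, c). \<alpha> a b c) \<and>
     (\<exists>k. 0 \<le> k \<and> k < 1 \<and>
        (\<forall>a\<ge>0. \<forall>b\<ge>0. a \<le> \<alpha> a b b \<or> a \<le> \<alpha> b a b \<or> a \<le> \<alpha> b b a \<longrightarrow> a \<le> k * b))}"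

definition common_fixed_point :: "'a set \<Rightarrow> ('a \<Rightarrow> 'a) \<Rightarrow> ('a \<Rightarrow> 'a) \<Rightarrow> 'a \<Rightarrow> bool" where
  "common_fixed_point X S T z \<longleftrightarrow> z \<in> X \<and> S z = z \<and> T z = z"

end

theory Submission
  imports Defs
begin

text \<open>The iterates obtained by applying \<open>T\<close> and \<open>S\<close> alternately satisfy
  \<open>\<delta> x\<^sub>n\<^sub>+\<^sub>1 x\<^sub>n\<^sub>+\<^sub>2 \<le> k * \<delta> x\<^sub>n x\<^sub>n\<^sub>+\<^sub>1\<close> by (A2), so they are Cauchy for \<open>\<delta>\<close>, hence for the smaller
  \<open>d\<close>, and converge in \<open>d\<close> to some \<open>z\<close>. Continuity of \<open>T\<close> along the even iterates gives \<open>T z = z\<close>;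
  hypothesis (v) gives \<open>\<delta> z z = 0\<close>, and then the contractive condition at \<open>(z, z)\<close> reads
  \<open>\<delta> z (S z) \<le> \<alpha> 0 0 (\<delta> z (S z))\<close>, so that \<open>S z = z\<close>.\<close>

context dislocated_metric_space
begin

lemma dconverges_compose:
  assumes "dconverges xs x" and "filterlim r sequentially sequentially"
  shows "dconverges (\<lambda>n. xs (r n)) x"
  using assms filterlim_compose[of "\<lambda>n. d (xs n) x" "nhds 0" sequentially r]
  unfolding dconverges_def by auto

lemma dconverges_unique:
  assumes "dconverges xs x" "dconverges xs y"
  shows "x = y"
proof (rule eq_if_zero)
  show "x \<in> X" "y \<in> X" using assms by (auto simp: dconverges_def)
  have in_X: "xs n \<in> X" for n using assms by (auto simp: dconverges_def)
  have "(\<lambda>n. d (xs n) x + d (xs n) y) \<longlonglongrightarrow> 0 + 0"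
    using assms by (intro tendsto_add) (auto simp: dconverges_def)
  moreover have "d x y \<le> d (xs n) x + d (xs n) y" for n
    using triangle[of x y "xs n"] commute[of x "xs n"] in_X \<open>x \<in> X\<close> \<open>y \<in> X\<close> by auto
  ultimately have "d x y \<le> 0"
    by (intro LIMSEQ_le_const[of _ 0]) auto
  then show "d x y = 0"
    using nonneg \<open>x \<in> X\<close> \<open>y \<in> X\<close> by (simp add: order_antisym)
qed

text \<open>Self-distances may be positive, but the triangle inequality through \<open>xs n\<close>
  bounds \<open>d x x\<close> by \<open>2 * d (xs n) x\<close>. The bare limit is assumed because it
  is what hypothesis (v) supplies for \<delta>.\<close>

lemma self_distance_zero_if_tendsto:
  assumes "range xs \<subseteq> X" "x \<in> X" "(\<lambda>n. d (xs n) x) \<longlonglongrightarrow> 0"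
  shows "d x x = 0"
proof (rule order_antisym)
  have "(\<lambda>n. d (xs n) x + d (xs n) x) \<longlonglongrightarrow> 0 + 0"
    using assms by (intro tendsto_add)
  moreover have "d x x \<le> d (xs n) x + d (xs n) x" for n
    using triangle[of x x "xs n"] commute[of x "xs n"] assms by auto
  ultimately show "d x x \<le> 0"
    using LIMSEQ_le_const[of "\<lambda>n. d (xs n) x + d (xs n) x" 0 "d x x"] by simp
qed (use assms nonneg in auto)

text \<open>Consecutive distances decay geometrically, so the distance from \<open>xs n\<close> to
  any later term is at most a tail of a geometric series.\<close>

lemma dcauchy_if_contractive:
  assumes in_X: "range xs \<subseteq> X" and k: "0 \<le> k" "k < 1"
    and contr: "\<And>n. d (xs (Suc n)) (xs (Suc (Suc n))) \<le> k * d (xs n) (xs (Suc n))"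
  shows "dcauchy xs"
proof -
  have X: "xs n \<in> X" for n using in_X by auto
  define C where "C = d (xs 0) (xs 1)"
  \<comment> \<open>Closed form of the tail of the series \<Sum> C * k^i over i \<ge> n.\<close>
  define B where "B n = C / (1 - k) * k ^ n" for n
  have step: "d (xs n) (xs (Suc n)) \<le> C * k ^ n" for n
  proof (induction n)
    case (Suc n)
    then show ?case
      using contr[of n] mult_left_mono[OF Suc k(1)] by (simp add: mult.left_commute)
  qed (simp add: C_def)
  have geometric: "C * k ^ n + B (Suc n) = B n" for n
    using k by (simp add: B_def field_simps)
  have B_nonneg: "B n \<ge> 0" for n
    using k nonneg X by (auto simp: B_def C_def)
  \<comment> \<open>The second index is strictly larger: a self-distance is not an empty sum of
    steps, so the bound could fail for equal indices.\<close>
  have tail: "d (xs n) (xs (Suc (n + m))) \<le> B n" for n m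
  proof (induction m arbitrary: n)
    case 0
    then show ?case
      using step[of n] geometric[of n] B_nonneg[of "Suc n"] by simp
  next
    case (Suc m)
    have "d (xs n) (xs (Suc (n + Suc m))) \<le> d (xs n) (xs (Suc n)) + d (xs (Suc n)) (xs (Suc (Suc n + m)))"
      using triangle[OF X X X] by simp
    also have "\<dots> \<le> C * k ^ n + B (Suc n)"
      using step[of n] Suc[of "Suc n"] by (intro add_mono) simp_all
    finally show ?case by (simp add: geometric)
  qed
  have "\<exists>N. \<forall>m\<ge>N. \<forall>n\<ge>N. d (xs m) (xs n) < \<epsilon>" if "\<epsilon> > 0" for \<epsilon>
  proof -
    have "(\<lambda>n. B n + B n) \<longlonglongrightarrow> 0"
      unfolding B_def using k by (auto intro!: tendsto_eq_intros LIMSEQ_power_zero)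
    then have "eventually (\<lambda>n. B n + B n < \<epsilon>) sequentially"
      using that by (rule order_tendstoD)
    then obtain N where N: "B N + B N < \<epsilon>"
      by (auto simp: eventually_sequentially)
    \<comment> \<open>Both indices lie strictly beyond N, so the detour through \<open>xs N\<close>
      uses \<open>tail\<close> twice. This needs no ordering of m and n and covers m = n.\<close>
    have "d (xs m) (xs n) < \<epsilon>" if mn: "m \<ge> Suc N" "n \<ge> Suc N" for m n
    proof -
      have "d (xs N) (xs i) \<le> B N" if "i \<ge> Suc N" for i
        using tail[of N "i - Suc N"] that by simp
      from this[OF mn(1)] this[OF mn(2)] show ?thesis
        using N triangle[OF X X X, of m n N] commute[OF X X, of m N] by linarith
    qed
    then show ?thesis by blast
  qed
  then show ?thesis using in_X by (simp add: dcauchy_def)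
qed

end

text \<open>T acts at even indices, so the odd iterates are the T-images of the even ones, the form
  in which continuity of T is applied.\<close>

primrec alternating_orbit :: "('a \<Rightarrow> 'a) \<Rightarrow> ('a \<Rightarrow> 'a) \<Rightarrow> 'a \<Rightarrow> nat \<Rightarrow> 'a" where
  "alternating_orbit S T x 0 = x"
| "alternating_orbit S T x (Suc n) =
     (if even n then T else S) (alternating_orbit S T x n)"

lemma alternating_orbit_in:
  assumes "S \<in> X \<rightarrow> X" "T \<in> X \<rightarrow> X" "x \<in> X"
  shows "alternating_orbit S T x n \<in> X"
  using assms by (induction n) auto

theorem theorem3p10:
  fixes X :: "'a set" and d \<delta> :: "'a \<Rightarrow> 'a \<Rightarrow> real" and S T :: "'a \<Rightarrow> 'a"
  assumes "dislocated_metric_space X d"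
    and "dislocated_metric_space X \<delta>"
    and "S \<in> X \<rightarrow> X" and "T \<in> X \<rightarrow> X"
    and "\<forall>x\<in>X. \<forall>y\<in>X. d x y \<le> \<delta> x y"
    and "dislocated_metric_space.dcomplete X d"
    and "dislocated_metric_space.seq_continuous X d T"
    and "\<exists>\<alpha>\<in>class_A. \<forall>x\<in>X. \<forall>y\<in>X.
           \<delta> (T x) (S y) \<le> \<alpha> (\<delta> x y) (\<delta> x (T x)) (\<delta> y (S y)) \<and>
           \<delta> (S y) (T x) \<le> \<alpha> (\<delta> y x) (\<delta> y (S y)) (\<delta> x (T x))"
    and "\<forall>xs x. dislocated_metric_space.dconverges X d xs x \<longrightarrow> (\<lambda>n. \<delta> (xs n) x) \<longlonglongrightarrow> 0"
  shows "(\<exists>!z. common_fixed_point X S T z) \<and>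
         (\<forall>z. common_fixed_point X S T z \<longrightarrow> d z z = 0 \<and> \<delta> z z = 0)"
proof -
  interpret D: dislocated_metric_space X d by fact
  interpret E: dislocated_metric_space X \<delta> by fact
  obtain \<alpha> k where k: "0 \<le> k" "k < 1"
    and A2: "\<And>a b. \<lbrakk>0 \<le> a; 0 \<le> b; a \<le> \<alpha> a b b \<or> a \<le> \<alpha> b a b \<or> a \<le> \<alpha> b b a\<rbrakk> \<Longrightarrow> a \<le> k * b"
    and TS: "\<And>x y. \<lbrakk>x \<in> X; y \<in> X\<rbrakk> \<Longrightarrow> \<delta> (T x) (S y) \<le> \<alpha> (\<delta> x y) (\<delta> x (T x)) (\<delta> y (S y))"
    and ST: "\<And>x y. \<lbrakk>x \<in> X; y \<in> X\<rbrakk> \<Longrightarrow> \<delta> (S y) (T x) \<le> \<alpha> (\<delta> y x) (\<delta> y (S y)) (\<delta> x (T x))"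
  proof -
    obtain \<alpha> where "\<alpha> \<in> class_A" and \<alpha>: "\<forall>x\<in>X. \<forall>y\<in>X.
           \<delta> (T x) (S y) \<le> \<alpha> (\<delta> x y) (\<delta> x (T x)) (\<delta> y (S y)) \<and>
           \<delta> (S y) (T x) \<le> \<alpha> (\<delta> y x) (\<delta> y (S y)) (\<delta> x (T x))"
      using assms(8) by blast
    then obtain k where "0 \<le> k" "k < 1"
      "\<forall>a\<ge>0. \<forall>b\<ge>0. a \<le> \<alpha> a b b \<or> a \<le> \<alpha> b a b \<or> a \<le> \<alpha> b b a \<longrightarrow> a \<le> k * b"
      by (auto simp: class_A_def)
    with \<alpha> show thesis by (intro that[of k \<alpha>]) blast+
  qed
  have S_in: "S x \<in> X" and T_in: "T x \<in> X" if "x \<in> X" for x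
    using assms(3,4) that by auto

  have self_zero: "\<delta> z z = 0" if "common_fixed_point X S T z" for z
  proof -
    have z: "z \<in> X" "S z = z" "T z = z" using that by (auto simp: common_fixed_point_def)
    \<comment> \<open>At (z, z) all three arguments of \<alpha> equal \<open>\<delta> z z\<close>,
      so (A2) applies with a = b; then k < 1 forces the value 0.\<close>
    then have "\<delta> z z \<le> k * \<delta> z z"
      using A2 TS[of z z] E.nonneg by simp
    then show ?thesis
      using k E.nonneg[of z z] z by (smt (verit) mult_left_less_imp_less mult_le_cancel_right1)
  qed
  have unique: "u = v" if "common_fixed_point X S T u" "common_fixed_point X S T v" for u v
  proof -
    have uv: "u \<in> X" "S u = u" "T u = u" "v \<in> X" "S v = v" "T v = v"
      using that by (auto simp: common_fixed_point_def)
    \<comment> \<open>The self-distances of u and v vanish, so the contractive condition reads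
      \<open>\<delta> u v \<le> \<alpha> (\<delta> u v) 0 0\<close>, which is (A2) with b =
      0.\<close>
    have "\<delta> u v \<le> k * 0"
      using A2[of "\<delta> u v" 0] TS[of u v] E.nonneg uv self_zero that by simp
    then show ?thesis
      using E.eq_if_zero[of u v] E.nonneg[of u v] uv by simp
  qed

  obtain x0 where "x0 \<in> X" using E.nonempty by blast
  define xs where "xs = alternating_orbit S T x0"
  have xs_in: "xs n \<in> X" for n
    unfolding xs_def using assms(3,4) \<open>x0 \<in> X\<close> by (rule alternating_orbit_in)
  have "\<delta> (xs (Suc n)) (xs (Suc (Suc n))) \<le> k * \<delta> (xs n) (xs (Suc n))" for n
  proof (rule A2)
    \<comment> \<open>For even n this is \<open>TS\<close> at (x_n, x_{n+1}); for odd n it is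
      \<open>ST\<close> with the roles of x and y exchanged. Having both inequalities in (iv) gives
      the same argument order for either parity, namely the pattern (b, b, a) of (A2).\<close>
    have "\<delta> (xs (Suc n)) (xs (Suc (Suc n))) \<le>
      \<alpha> (\<delta> (xs n) (xs (Suc n))) (\<delta> (xs n) (xs (Suc n))) (\<delta> (xs (Suc n)) (xs (Suc (Suc n))))"
      using TS[of "xs n" "xs (Suc n)"] ST[of "xs (Suc n)" "xs n"] xs_in[of n] xs_in[of "Suc n"]
      by (cases "even n") (simp_all add: xs_def)
    then show "\<delta> (xs (Suc n)) (xs (Suc (Suc n)))
        \<le> \<alpha> (\<delta> (xs (Suc n)) (xs (Suc (Suc n)))) (\<delta> (xs n) (xs (Suc n))) (\<delta> (xs n) (xs (Suc n))) \<or>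
      \<delta> (xs (Suc n)) (xs (Suc (Suc n)))
        \<le> \<alpha> (\<delta> (xs n) (xs (Suc n))) (\<delta> (xs (Suc n)) (xs (Suc (Suc n)))) (\<delta> (xs n) (xs (Suc n))) \<or>
      \<delta> (xs (Suc n)) (xs (Suc (Suc n)))
        \<le> \<alpha> (\<delta> (xs n) (xs (Suc n))) (\<delta> (xs n) (xs (Suc n))) (\<delta> (xs (Suc n)) (xs (Suc (Suc n))))"
      by blast
  qed (auto intro: E.nonneg xs_in)
  then have "E.dcauchy xs"
    using k xs_in by (intro E.dcauchy_if_contractive) auto
  then have "D.dcauchy xs"
    using assms(5) unfolding D.dcauchy_def E.dcauchy_def
    by (meson order_le_less_trans rangeI subsetD)
  then obtain z where z: "D.dconverges xs z"
    using assms(6) by (auto simp: D.dcomplete_def)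
  then have zX: "z \<in> X" by (simp add: D.dconverges_def)

  have "filterlim (\<lambda>n::nat. 2 * n) sequentially sequentially"
    "filterlim (\<lambda>n::nat. Suc (2 * n)) sequentially sequentially"
    by (auto intro!: filterlim_subseq strict_monoI)
  then have even: "D.dconverges (\<lambda>n. xs (2 * n)) z" and odd: "D.dconverges (\<lambda>n. xs (Suc (2 * n))) z"
    using D.dconverges_compose[OF z] by blast+
  have "D.dconverges (\<lambda>n. T (xs (2 * n))) (T z)"
    using assms(7) even zX by (simp add: D.seq_continuous_def)
  then have "D.dconverges (\<lambda>n. xs (Suc (2 * n))) (T z)"
    by (simp add: xs_def)
  \<comment> \<open>The odd iterates converge in d both to T z and, as a subsequence, to z.\<close>
  then have Tz: "T z = z"
    using odd by (rule D.dconverges_unique)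
  have "\<delta> z z = 0"
    using assms(9) z xs_in zX by (intro E.self_distance_zero_if_tendsto[of xs]) auto
  then have "\<delta> z (S z) \<le> k * 0"
    using A2[of "\<delta> z (S z)" 0] TS[of z z] Tz zX S_in E.nonneg by simp
  then have "S z = z"
    using E.eq_if_zero[of z "S z"] E.nonneg[of z "S z"] zX S_in by simp
  then have "common_fixed_point X S T z"
    using Tz zX by (simp add: common_fixed_point_def)
  \<comment> \<open>Hypothesis (i) squeezes \<open>d u u\<close> between 0 and
    \<open>\<delta> u u = 0\<close>.\<close>
  moreover have "d u u = 0" if "common_fixed_point X S T u" for u
    using that self_zero[OF that] assms(5) D.nonneg[of u u]
    by (force simp: common_fixed_point_def)
  ultimately show ?thesis
    using unique self_zero by blast
qed

end
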